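(* Let $a\in\mathbb{R}$, $n\in\mathbb{Z}_+$, $\alpha>0$, and let $w:\mathbb{N}_a\to\mathbb{R}\setminus\{0\}$ satisfy $\frac{w(a)}{w(k)}>0$ for all $k\in\mathbb{N}_{a+1}$. Let $u_i:\mathbb{N}_{a+1}\to\mathbb{R}$, $i=1,2,\dots,n$, be positive increasing functions. Then for all $k\in\mathbb{N}_{a+1}$, $$\Big({}_a^{\rm G}\nabla_k^{-\alpha,w(k)}\prod_{i=1}^n u_i(k)\Big)\,\Big[{}_a^{\rm G}\nabla_k^{-\alpha,w(k)}1\Big]^{n-1}\ge \prod_{i=1}^n {}_a^{\rm G}\nabla_k^{-\alpha,w(k)}u_i(k).$$
   Context: For $a\in\mathbb{R}$, $\mathbb{N}_a:=\{a,a+1,a+2,\dots\}$. The rising function is $p^{\overline{q}}:=\frac{\Gamma(p+q)}{\Gamma(p)}$. For $\alpha>0$ and $k\in\mathbb{N}_{a+1}$, the Grünwald–Letnikov fractional sum is ${}_a^{\rm G}\nabla_k^{-\alpha}x(k):=\sum_{j=a+1}^{k}\frac{(k-j+1)^{\overline{\alpha-1}}}{\Gamma(\alpha)}x(j)$, and the tempered sum is ${}_a^{\rm G}\nabla_k^{-\alpha,w(k)}x(k):=w^{-1}(k)\,{}_a^{\rm G}\nabla_k^{-\alpha}[w(k)x(k)]=\sum_{j=a+1}^{k}\frac{(k-j+1)^{\overline{\alpha-1}}}{\Gamma(\alpha)}\frac{w(j)}{w(k)}x(j)$. ${}_a^{\rm G}\nabla_k^{-\alpha,w(k)}1$ is the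 operator applied to the constant sequence $1$. *)

theory Defs
  imports "HOL-Analysis.Analysis"
begin

text \<open>
  Functions on the discrete half-line \<open>\<nat>\<^sub>a = {a, a + 1, a + 2, \<dots>}\<close> are represented by total functions
  \<^typ>\<open>real \<Rightarrow> real\<close>, of which only the values on \<open>\<nat>\<^sub>a\<close> matter.
\<close>

definition nats_from :: "real \<Rightarrow> real set" where
  "nats_from a = range (\<lambda>m::nat. a + real m)"

definition rising :: "real \<Rightarrow> real \<Rightarrow> real" where
  "rising p q = Gamma (p + q) / Gamma p"

text \<open>
  The sum over \<open>j = a + 1, \<dots>, k\<close> steps by 1 from the real number \<open>a + 1\<close>.
  The order of the sum is \<open>\<alpha>\<close>, that is, this is \<open>\<nabla>\<close> with exponent \<open>-\<alpha>\<close>.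
\<close>

definition GL_sum :: "real \<Rightarrow> real \<Rightarrow> (real \<Rightarrow> real) \<Rightarrow> real \<Rightarrow> real" where
  "GL_sum a \<alpha> x k =
     (\<Sum>j\<in>{j \<in> nats_from (a + 1). j \<le> k}. rising (k - j + 1) (\<alpha> - 1) / Gamma \<alpha> * x j)"

definition tempered_GL_sum ::
  "real \<Rightarrow> real \<Rightarrow> (real \<Rightarrow> real) \<Rightarrow> (real \<Rightarrow> real) \<Rightarrow> real \<Rightarrow> real" where
  "tempered_GL_sum a \<alpha> w x k = inverse (w k) * GL_sum a \<alpha> (\<lambda>j. w j * x j) k"

lemma finite_nats_from_le: "finite {j \<in> nats_from a. j \<le> k}"
proof (rule finite_subset)
  show "{j \<in> nats_from a. j \<le> k} \<subseteq> (\<lambda>m::nat. a + real m) ` {..nat \<lceil>k - a\<rceil>}"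
    unfolding nats_from_def by (auto intro!: imageI; linarith)
qed simp

lemma tempered_GL_sum_eq:
  "tempered_GL_sum a \<alpha> w x k =
     (\<Sum>j\<in>{j \<in> nats_from (a + 1). j \<le> k}.
        rising (k - j + 1) (\<alpha> - 1) / Gamma \<alpha> * (w j / w k) * x j)"
  unfolding tempered_GL_sum_def GL_sum_def sum_distrib_left
  by (rule sum.cong) (simp_all add: divide_inverse mult_ac)

end

theory Submission
  imports Defs
begin

text \<open>
  The tempered sum at \<open>k\<close> is a finite sum \<open>\<Sum>j. c j * x j\<close> whose weights
  \<open>c j = rising (k - j + 1) (\<alpha> - 1) / Gamma \<alpha> * (w j / w k)\<close> do not depend on \<open>x\<close>.  They are
  positive: the Gamma factors have positive arguments, and \<open>w j\<close> and \<open>w k\<close> have the same sign,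
  that of \<open>w a\<close> (\<open>GL_weight_pos\<close>).  The theorem is therefore Chebyshev's sum inequality for a
  positive measure and \<open>n\<close> increasing functions (\<open>weighted_Chebyshev_prod\<close>).  That inequality
  follows from the case of two functions by induction on the number of factors, because a product of
  nonnegative increasing functions is again nonnegative and increasing.
\<close>

text \<open>
  Symmetrization: twice the difference of the two sides is the double sum of
  \<open>c i * c j * ((f i - f j) * (g i - g j))\<close>, and each term is nonnegative because \<open>f\<close> and \<open>g\<close>
  order \<open>i\<close> and \<open>j\<close> in the same way.
\<close>

lemma weighted_Chebyshev:
  fixes c f g :: "'a::linorder \<Rightarrow> real"
  assumes c: "\<And>j. j \<in> A \<Longrightarrow> c j \<ge> 0"
    and f: "mono_on A f" and g: "mono_on A g"
  shows "(\<Sum>j\<in>A. c j * f j) * (\<Sum>j\<in>A. c j * g j) \<le> (\<Sum>j\<in>A. c j) * (\<Sum>j\<in>A. c j * (f j * g j))"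
proof -
  let ?C = "\<Sum>j\<in>A. c j" and ?F = "\<Sum>j\<in>A. c j * f j" and ?G = "\<Sum>j\<in>A. c j * g j"
    and ?H = "\<Sum>j\<in>A. c j * (f j * g j)"
  have same_order: "0 \<le> (f i - f j) * (g i - g j)" if "i \<in> A" "j \<in> A" for i j
  proof (cases "i \<le> j")
    case True
    with that f g have "f i \<le> f j" "g i \<le> g j" by (auto simp: mono_on_def)
    then show ?thesis by (intro mult_nonpos_nonpos) simp_all
  next
    case False
    with that f g have "f j \<le> f i" "g j \<le> g i" by (auto simp: mono_on_def)
    then show ?thesis by simp
  qed
  have "0 \<le> (\<Sum>i\<in>A. \<Sum>j\<in>A. c i * c j * ((f i - f j) * (g i - g j)))"
    by (intro sum_nonneg mult_nonneg_nonneg c same_order)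
  also have "\<dots> = (\<Sum>i\<in>A. \<Sum>j\<in>A. (c i * (f i * g i)) * c j - (c i * f i) * (c j * g j)
                                 - (c i * g i) * (c j * f j) + c i * (c j * (f j * g j)))"
    by (simp add: algebra_simps)
  also have "\<dots> = ?H * ?C - ?F * ?G - ?G * ?F + ?C * ?H"
    by (simp add: sum.distrib sum_subtractf sum_product)
  finally show ?thesis by (simp add: algebra_simps)
qed

lemma mono_on_prod:
  fixes u :: "'i \<Rightarrow> 'a::order \<Rightarrow> real"
  assumes "\<And>i j. i \<in> I \<Longrightarrow> j \<in> A \<Longrightarrow> u i j \<ge> 0" "\<And>i. i \<in> I \<Longrightarrow> mono_on A (u i)"
  shows "mono_on A (\<lambda>j. \<Prod>i\<in>I. u i j)"
  using assms by (intro mono_onI prod_mono) (auto simp: mono_on_def)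

lemma weighted_Chebyshev_prod:
  fixes c :: "'a::linorder \<Rightarrow> real" and u :: "'i \<Rightarrow> 'a \<Rightarrow> real"
  assumes "finite I" "I \<noteq> {}"
    and c: "\<And>j. j \<in> A \<Longrightarrow> c j \<ge> 0"
    and "\<And>i j. i \<in> I \<Longrightarrow> j \<in> A \<Longrightarrow> u i j \<ge> 0"
    and "\<And>i. i \<in> I \<Longrightarrow> mono_on A (u i)"
  shows "(\<Prod>i\<in>I. \<Sum>j\<in>A. c j * u i j)
       \<le> (\<Sum>j\<in>A. c j * (\<Prod>i\<in>I. u i j)) * (\<Sum>j\<in>A. c j) ^ (card I - 1)"
  using assms(1,2,4,5)
proof (induction I rule: finite_ne_induct)
  case (singleton i)
  then show ?case by simp
next
  case (insert i I)
  let ?C = "\<Sum>j\<in>A. c j" and ?S = "\<Sum>j\<in>A. c j * u i j"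
    and ?P = "\<Sum>j\<in>A. c j * (\<Prod>i\<in>I. u i j)"
  have C: "?C \<ge> 0" using c by (rule sum_nonneg)
  have S: "?S \<ge> 0" using c insert.prems(1) by (intro sum_nonneg mult_nonneg_nonneg) auto
  have "(\<Prod>i\<in>insert i I. \<Sum>j\<in>A. c j * u i j) = ?S * (\<Prod>i\<in>I. \<Sum>j\<in>A. c j * u i j)"
    using insert.hyps by simp
  also have "\<dots> \<le> ?S * (?P * ?C ^ (card I - 1))"
    using insert.IH insert.prems S by (intro mult_left_mono) auto
  also have "\<dots> = (?S * ?P) * ?C ^ (card I - 1)"
    by simp
  also have "\<dots> \<le> (?C * (\<Sum>j\<in>A. c j * (u i j * (\<Prod>i\<in>I. u i j)))) * ?C ^ (card I - 1)"
    using insert.prems c C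
    by (intro mult_right_mono weighted_Chebyshev mono_on_prod) auto
  also have "\<dots> = (\<Sum>j\<in>A. c j * (\<Prod>i\<in>insert i I. u i j)) * ?C ^ (card (insert i I) - 1)"
  proof -
    have "card I > 0" using insert.hyps by (simp add: card_gt_0_iff)
    then have "?C * ?C ^ (card I - 1) = ?C ^ (card (insert i I) - 1)"
      using insert.hyps by (simp flip: power_Suc)
    then show ?thesis using insert.hyps by (simp add: mult_ac)
  qed
  finally show ?case .
qed

lemma GL_weight_pos:
  fixes a \<alpha> :: real
  assumes "\<alpha> > 0" "j \<le> k" "w a / w j > 0" "w a / w k > 0"
  shows "rising (k - j + 1) (\<alpha> - 1) / Gamma \<alpha> * (w j / w k) > 0"
proof -
  have "rising (k - j + 1) (\<alpha> - 1) > 0"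
    using assms by (simp add: rising_def Gamma_real_pos)
  moreover have "w j / w k > 0"
    using assms(3,4) by (auto simp: zero_less_divide_iff)
  ultimately show ?thesis
    using assms(1) by (metis Gamma_real_pos divide_pos_pos mult_pos_pos)
qed

theorem theorem3p14:
  fixes a \<alpha> :: real and n :: nat and w :: "real \<Rightarrow> real" and u :: "nat \<Rightarrow> real \<Rightarrow> real"
  assumes "n \<ge> 1"
    and "\<alpha> > 0"
    and "\<forall>k\<in>nats_from a. w k \<noteq> 0"
    and "\<forall>k\<in>nats_from (a + 1). w a / w k > 0"
    and "\<forall>i\<in>{1..n}. \<forall>k\<in>nats_from (a + 1). u i k > 0"
    and "\<forall>i\<in>{1..n}. mono_on (nats_from (a + 1)) (u i)"
  shows "\<forall>k\<in>nats_from (a + 1).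
    tempered_GL_sum a \<alpha> w (\<lambda>j. \<Prod>i=1..n. u i j) k * (tempered_GL_sum a \<alpha> w (\<lambda>j. 1) k) ^ (n - 1)
      \<ge> (\<Prod>i=1..n. tempered_GL_sum a \<alpha> w (u i) k)"
proof
  fix k assume k: "k \<in> nats_from (a + 1)"
  define A where "A = {j \<in> nats_from (a + 1). j \<le> k}"
  define c where "c j = rising (k - j + 1) (\<alpha> - 1) / Gamma \<alpha> * (w j / w k)" for j
  have eq: "tempered_GL_sum a \<alpha> w x k = (\<Sum>j\<in>A. c j * x j)" for x
    unfolding tempered_GL_sum_eq A_def c_def ..
  have "c j \<ge> 0" if "j \<in> A" for j
    using that k assms(2,4) unfolding A_def c_def by (intro less_imp_le[OF GL_weight_pos]) auto
  moreover have "u i j \<ge> 0" if "i \<in> {1..n}" "j \<in> A" for i j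
    using that assms(5) by (auto simp: A_def intro: less_imp_le)
  moreover have "mono_on A (u i)" if "i \<in> {1..n}" for i
    using that assms(6) by (auto simp: A_def intro: mono_on_subset)
  ultimately have "(\<Prod>i\<in>{1..n}. \<Sum>j\<in>A. c j * u i j)
       \<le> (\<Sum>j\<in>A. c j * (\<Prod>i\<in>{1..n}. u i j)) * (\<Sum>j\<in>A. c j) ^ (card {1..n} - 1)"
    using assms(1) by (intro weighted_Chebyshev_prod) auto
  then show "tempered_GL_sum a \<alpha> w (\<lambda>j. \<Prod>i=1..n. u i j) k
        * (tempered_GL_sum a \<alpha> w (\<lambda>j. 1) k) ^ (n - 1)
      \<ge> (\<Prod>i=1..n. tempered_GL_sum a \<alpha> w (u i) k)"
    by (simp add: eq)
qed

end
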